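(* Let $t \geq 2$ be an integer, let $n \geq 2$ be an integer, and write $n = pm$ with $p$ a prime. Let $k$ be the smallest integer such that $k \geq 3$ and $\gcd(n,k) = 1$. Then $$(t+2)n - k + 1 \leq s'_{nt}\left((\mathbb{Z}/n\mathbb{Z})^2\right) \leq (t+2)n + m - 3.$$
   Context: A sequence in an abelian group $G$ is a finite list of elements of $G$ (repetitions allowed); a subsequence is obtained by selecting any subset of the positions (not necessarily consecutive). A sequence is zero-sum if its terms sum to $0$ in $G$. For a positive integer $L$, the modified Erdős–Ginzburg–Ziv constant $s'_L(G)$ is the smallest integer $\ell$ such that every zero-sum sequence in $G$ of length at least $\ell$ contains a zero-sum subsequence of length $L$. *)

theory Defs
  imports
    "HOL-Algebra.Elementary_Groups"
    "HOL-Library.Sublist"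
    "HOL-Computational_Algebra.Primes"
begin

text \<open>
  Groups are written multiplicatively in HOL-Algebra, so a zero-sum sequence is a list over
  the carrier whose product is \<open>\<one>\<close>.
\<close>

definition zero_sum :: "('a, 'b) monoid_scheme \<Rightarrow> 'a list \<Rightarrow> bool" where
  "zero_sum G xs \<longleftrightarrow> set xs \<subseteq> carrier G \<and> foldr (\<otimes>\<^bsub>G\<^esub>) xs \<one>\<^bsub>G\<^esub> = \<one>\<^bsub>G\<^esub>"

definition egz_mod_bound :: "('a, 'b) monoid_scheme \<Rightarrow> nat \<Rightarrow> nat \<Rightarrow> bool" where
  "egz_mod_bound G L l \<longleftrightarrow>
     (\<forall>xs. zero_sum G xs \<longrightarrow> l \<le> length xs \<longrightarrow>
       (\<exists>ys. subseq ys xs \<and> length ys = L \<and> zero_sum G ys))"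

text \<open>
  For \<open>L > 0\<close> the minimum over the integers equals the minimum over the natural numbers, since
  the empty sequence is zero-sum and rules out every bound \<open>l \<le> 0\<close>. The minimum need not exist
  for an arbitrary \<open>L\<close> (then \<open>LEAST\<close> is unspecified); \<open>egz_mod_bound_exists\<close> below
  shows that it exists whenever \<open>G\<close> is finite and its exponent divides \<open>L\<close>.
\<close>

definition egz_mod :: "('a, 'b) monoid_scheme \<Rightarrow> nat \<Rightarrow> nat" where
  "egz_mod G L = (LEAST l. egz_mod_bound G L l)"

abbreviation Zmod_square :: "nat \<Rightarrow> (int \<times> int) monoid" where
  "Zmod_square n \<equiv> integer_mod_group n \<times>\<times> integer_mod_group n"

lemma egz_mod_bound_exists:
  fixes G (structure)
  assumes "group G" and fin: "finite (carrier G)"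
    and exponent: "\<And>x. x \<in> carrier G \<Longrightarrow> x [^] L = \<one>"
  shows "\<exists>l. egz_mod_bound G L l"
proof -
  interpret group G by fact
  have "egz_mod_bound G L (Suc (card (carrier G) * L))"
    unfolding egz_mod_bound_def
  proof (intro allI impI)
    fix xs
    assume zs: "zero_sum G xs" and len: "Suc (card (carrier G) * L) \<le> length xs"
    have sub: "set xs \<subseteq> carrier G" using zs by (simp add: zero_sum_def)
    have "\<exists>a\<in>carrier G. L \<le> count_list xs a"
    proof (rule ccontr)
      assume "\<not> ?thesis"
      then have *: "\<And>a. a \<in> set xs \<Longrightarrow> count_list xs a \<le> L" using sub by force
      have "length xs = (\<Sum>a\<in>set xs. count_list xs a)"
        by (simp add: sum_count_set)
      also have "\<dots> \<le> card (set xs) * L"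
        using sum_bounded_above[of "set xs" "count_list xs" L] * by simp
      also have "\<dots> \<le> card (carrier G) * L"
        by (intro mult_right_mono card_mono fin sub) simp
      finally show False using len by simp
    qed
    then obtain a where a: "a \<in> carrier G" "L \<le> count_list xs a" by blast
    have "filter ((=) a) xs = replicate (count_list xs a) a"
      by (induction xs) auto
    then have "subseq (replicate (count_list xs a) a) xs"
      by (metis subseq_filter_left)
    moreover have "prefix (replicate L a) (replicate (count_list xs a) a)"
      using a(2) by (metis le_add_diff_inverse replicate_add prefixI)
    ultimately have s: "subseq (replicate L a) xs"
      using prefix_imp_subseq subseq_order.trans by blast
    have "foldr (\<otimes>) (replicate j a) \<one> = a [^] j" for j
      using a(1) by (induction j) (simp, metis foldr.simps(2) comp_apply nat_pow_Suc2 replicate_Suc foldr_Cons)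
    then have "zero_sum G (replicate L a)"
      using a(1) exponent by (auto simp: zero_sum_def)
    with s show "\<exists>ys. subseq ys xs \<and> length ys = L \<and> zero_sum G ys" by auto
  qed
  then show ?thesis ..
qed

lemma egz_mod_bound_exists_Zmod_square:
  assumes "0 < n"
  shows "\<exists>l. egz_mod_bound (Zmod_square n) (n * t) l"
proof (rule egz_mod_bound_exists)
  interpret Z: group "integer_mod_group n" by simp
  show g: "group (Zmod_square n)" by (intro DirProd_group) simp_all
  interpret group "Zmod_square n" by (fact g)
  show "finite (carrier (Zmod_square n))"
    using assms by (simp add: carrier_integer_mod_group)
  fix x assume x: "x \<in> carrier (Zmod_square n)"
  obtain a b where [simp]: "x = (a, b)" by (cases x)
  have "x [^]\<^bsub>Zmod_square n\<^esub> j
      = (a [^]\<^bsub>integer_mod_group n\<^esub> j, b [^]\<^bsub>integer_mod_group n\<^esub> j)" for j :: nat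
    by (induction j) (simp_all del: pow_integer_mod_group mult_integer_mod_group)
  then show "x [^]\<^bsub>Zmod_square n\<^esub> (n * t) = \<one>\<^bsub>Zmod_square n\<^esub>"
    using x by simp
qed

end

theory Submission
  imports Defs "HOL-Number_Theory.Residues" "HOL-Library.Disjoint_Sets"
begin

text \<open>
  Lower bound: among \<open>nt + 2 - k\<close> copies of \<open>(c, c)\<close> and \<open>n - 1\<close> copies each of
  \<open>(c + 1, c)\<close> and \<open>(c, c + 1)\<close>, a zero-sum subsequence whose length is a multiple of \<open>n\<close> can only
  use \<open>(c, c)\<close>, of which there are fewer than \<open>nt\<close>. The whole sequence is zero-sum when
  \<open>k c \<equiv> -1\<close> modulo \<open>n\<close>, which is solvable because \<open>k\<close> is coprime to \<open>n\<close>.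

  Upper bound: by Reiher's theorem (the Kemnitz conjecture) any \<open>4m - 3\<close> elements contain
  \<open>m\<close> with sum zero modulo \<open>m\<close>, so disjoint blocks of size \<open>m\<close> can be
  extracted until \<open>(t + 2)p - 2\<close> of them are available. Dividing the block sums by \<open>m\<close> leaves
  the problem of finding \<open>tp\<close> blocks with sum zero modulo \<open>p\<close>, which follows from
  Reiher's theorem for \<open>p\<close> and the fact that \<open>3p - 2\<close> elements contain a zero-sum of size
  \<open>p\<close> or \<open>2p\<close>.

  Reiher's theorem for odd primes rests on congruences between the numbers of zero-sum subsets of
  given sizes. In place of Chevalley--Warning, these come from the vanishing of
  \<open>\<Sum>I\<subseteq>J. (-1)^|I| F(I)\<close> for set functions \<open>F\<close> that are polynomials of degree less than
  \<open>|J|\<close> in the indicators of the elements, where Fermat's little theorem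
  turns the zero-sum condition into such a polynomial.
\<close>

subsection \<open>Alternating sums of set functions of bounded degree\<close>

text \<open>Polynomials of degree at most \<open>d\<close> in the indicators of the elements of
  \<open>J\<close>. Indicators are idempotent, so a monomial is just a set \<open>T\<close>, with
  value \<open>of_bool (T \<subseteq> I)\<close>.\<close>

inductive sf_degree :: "'a set \<Rightarrow> nat \<Rightarrow> ('a set \<Rightarrow> int) \<Rightarrow> bool" for J where
  monomial: "T \<subseteq> J \<Longrightarrow> card T \<le> d \<Longrightarrow> sf_degree J d (\<lambda>I. of_bool (T \<subseteq> I) * c)"
| add: "sf_degree J d F \<Longrightarrow> sf_degree J d G \<Longrightarrow> sf_degree J d (\<lambda>I. F I + G I)"
| cong: "sf_degree J d F \<Longrightarrow> (\<And>I. I \<subseteq> J \<Longrightarrow> G I = F I) \<Longrightarrow> sf_degree J d G"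

lemma sf_degree_const: "sf_degree J d (\<lambda>_. c)"
  using sf_degree.monomial[of "{}" J d c] by simp

lemma sf_degree_sum:
  assumes "finite A" "\<And>x. x \<in> A \<Longrightarrow> sf_degree J d (F x)"
  shows "sf_degree J d (\<lambda>I. \<Sum>x\<in>A. F x I)"
  using assms by (induction A rule: finite_induct) (auto intro: sf_degree_const sf_degree.add)

lemma sf_degree_mult:
  assumes "sf_degree J d F" "sf_degree J e G"
  shows "sf_degree J (d + e) (\<lambda>I. F I * G I)"
  using assms(1)
proof induction
  case (monomial T d c)
  from assms(2) show ?case
  proof induction
    case mono: (monomial T' e c')
    have "card (T \<union> T') \<le> d + e"
      using card_Un_le[of T T'] monomial mono by linarith
    then have "sf_degree J (d + e) (\<lambda>I. of_bool (T \<union> T' \<subseteq> I) * (c * c'))"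
      using monomial mono by (intro sf_degree.monomial) auto
    then show ?case by (rule sf_degree.cong) auto
  next
    case (add e F G)
    show ?case using sf_degree.add[OF add.IH] by (simp add: algebra_simps)
  next
    case (cong e F G)
    show ?case by (rule sf_degree.cong[OF cong.IH]) (simp add: cong.hyps)
  qed
next
  case (add d F G)
  show ?case using sf_degree.add[OF add.IH] by (simp add: algebra_simps)
next
  case (cong d F G)
  show ?case by (rule sf_degree.cong[OF cong.IH]) (simp add: cong.hyps)
qed

lemma sf_degree_power:
  assumes "sf_degree J d F"
  shows "sf_degree J (k * d) (\<lambda>I. F I ^ k)"
  by (induction k) (use sf_degree_const sf_degree_mult[OF assms] in auto)

lemma sf_degree_diff:
  assumes "sf_degree J d F" "sf_degree J d G"
  shows "sf_degree J d (\<lambda>I. F I - G I)"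
  using sf_degree.add[OF assms(1) sf_degree_mult[OF sf_degree_const[of J 0 "-1"] assms(2), simplified]]
  by simp

lemma sf_degree_set_sum:
  assumes "finite J"
  shows "sf_degree J 1 (\<lambda>I. sum a I)"
proof -
  have "sf_degree J 1 (\<lambda>I. \<Sum>x\<in>J. of_bool ({x} \<subseteq> I) * a x)"
    using assms by (intro sf_degree_sum sf_degree.monomial) auto
  then show ?thesis
  proof (rule sf_degree.cong)
    fix I assume "I \<subseteq> J"
    then show "sum a I = (\<Sum>x\<in>J. of_bool ({x} \<subseteq> I) * a x)"
      using assms by (intro sum.mono_neutral_cong_left) auto
  qed
qed

lemma sf_degree_card: "finite J \<Longrightarrow> sf_degree J 1 (\<lambda>I. int (card I))"
  using sf_degree_set_sum[of J "\<lambda>_. 1"] by simp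

text \<open>The subsets of \<open>I\<close> of size \<open>r\<close> are counted by a sum of
  monomials with integer coefficients. No division by r! occurs, which matters modulo p when r =
  p.\<close>

lemma sf_degree_card_choose:
  assumes "finite J"
  shows "sf_degree J r (\<lambda>I. int (card I choose r))"
proof -
  have "sf_degree J r (\<lambda>I. \<Sum>T\<in>{T. T \<subseteq> J \<and> card T = r}. of_bool (T \<subseteq> I) * 1)"
    using assms by (intro sf_degree_sum sf_degree.monomial) auto
  then show ?thesis
  proof (rule sf_degree.cong)
    fix I assume I: "I \<subseteq> J"
    have "{T. T \<subseteq> J \<and> card T = r} \<inter> {T. T \<subseteq> I} = {T. T \<subseteq> I \<and> card T = r}" using I by auto
    then show "int (card I choose r) = (\<Sum>T\<in>{T. T \<subseteq> J \<and> card T = r}. of_bool (T \<subseteq> I) * 1)"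
      using assms finite_subset[OF I assms] by (simp add: of_bool_def sum.If_cases n_subsets)
  qed
qed

text \<open>Differencing a power loses one degree, by (F+1)^(k+2) - F^(k+2) = (F+1) ((F+1)^(k+1) -
  F^(k+1)) + F^(k+1).\<close>

lemma sf_degree_power_step:
  assumes "sf_degree J 1 F"
  shows "sf_degree J k (\<lambda>I. (F I + 1) ^ Suc k - F I ^ Suc k)"
proof (induction k)
  case 0
  show ?case by (simp add: sf_degree_const)
next
  case (Suc k)
  have "sf_degree J (1 + k) (\<lambda>I. (F I + 1) * ((F I + 1) ^ Suc k - F I ^ Suc k))"
    by (intro sf_degree_mult Suc sf_degree.add assms sf_degree_const)
  moreover have "sf_degree J (1 + k) (\<lambda>I. F I ^ Suc k)"
    using sf_degree_power[OF assms, of "Suc k"] by simp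
  ultimately show ?case
    by (auto dest: sf_degree.add simp: algebra_simps)
qed

text \<open>Toggling an element of \<open>J\<close> outside \<open>T\<close> flips the sign and does
  not affect \<open>T \<subseteq> I\<close>.\<close>

lemma alternating_sum_superset:
  assumes "finite J" "T \<subset> J"
  shows "(\<Sum>I\<in>Pow J. (- 1) ^ card I * of_bool (T \<subseteq> I)) = (0::int)"
proof -
  obtain x where x: "x \<in> J" "x \<notin> T" using assms by auto
  define K where "K = J - {x}"
  have K: "finite K" "x \<notin> K" "J = insert x K" using x assms by (auto simp: K_def)
  have inj: "inj_on (insert x) (Pow K)" using K by (auto simp: inj_on_def)
  have c: "I \<subseteq> K \<Longrightarrow> card (insert x I) = Suc (card I)" for I
    using K by (subst card_insert_disjoint) (auto intro: finite_subset)
  have "T \<subseteq> insert x I \<longleftrightarrow> T \<subseteq> I" for I using x by auto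
  moreover have "Pow K \<inter> insert x ` Pow K = {}" using K by auto
  ultimately show ?thesis
    using K(1) c unfolding K(3) Pow_insert
    by (subst sum.union_disjoint) (simp_all add: sum.reindex[OF inj] sum_negf[symmetric] sum.distrib[symmetric] del: sum_of_bool_mult_eq sum_mult_of_bool_eq)
qed

lemma alternating_sum_eq_0:
  assumes "sf_degree J d F" "finite J" "d < card J"
  shows "(\<Sum>I\<in>Pow J. (- 1) ^ card I * F I) = 0"
  using assms(1,3)
proof induction
  case (monomial T d c)
  then have "T \<subset> J" by auto
  from alternating_sum_superset[OF assms(2) this] show ?case
    by (simp flip: sum_distrib_right mult.assoc)
next
  case (add d F G)
  then show ?case by (simp add: algebra_simps sum.distrib)
next
  case (cong d F G)
  then show ?case by (metis (no_types, lifting) PowD sum.cong)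
qed

subsection \<open>Numbers of zero-sum subsets modulo a prime\<close>

definition zsum_mod :: "nat \<Rightarrow> ('a \<Rightarrow> int) \<Rightarrow> ('a \<Rightarrow> int) \<Rightarrow> 'a set \<Rightarrow> bool" where
  "zsum_mod n a b I \<longleftrightarrow> int n dvd sum a I \<and> int n dvd sum b I"

definition zsets :: "nat \<Rightarrow> ('a \<Rightarrow> int) \<Rightarrow> ('a \<Rightarrow> int) \<Rightarrow> 'a set \<Rightarrow> nat \<Rightarrow> 'a set set" where
  "zsets n a b J s = {I. I \<subseteq> J \<and> card I = s \<and> zsum_mod n a b I}"

lemma finite_zsets: "finite J \<Longrightarrow> finite (zsets n a b J s)"
  by (auto simp: zsets_def)

lemma fermat_indicator:
  fixes x :: int
  assumes "prime p"
  shows "[1 - x ^ (p - 1) = of_bool (int p dvd x)] (mod int p)"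
proof (cases "int p dvd x")
  case True
  moreover have "p - 1 > 0" using prime_gt_1_nat[OF assms] by simp
  ultimately have "int p dvd x ^ (p - 1)" by (meson dvd_power dvd_trans)
  with True show ?thesis by (simp add: cong_iff_dvd_diff)
next
  case False
  define y where "y = nat (x mod int p)"
  have y: "int y = x mod int p" using prime_gt_0_nat[OF assms] by (simp add: y_def)
  have "\<not> p dvd y"
    using False y by (metis dvd_mod_iff dvd_refl int_dvd_int_iff)
  then have "[int (y ^ (p - 1)) = int 1] (mod int p)"
    using fermat_theorem[OF assms] cong_int_iff by blast
  moreover have "[int y ^ (p - 1) = x ^ (p - 1)] (mod int p)"
    using y by (intro cong_pow) (simp add: cong_def)
  ultimately have "[x ^ (p - 1) = 1] (mod int p)"
    by (metis cong_sym cong_trans of_nat_1 of_nat_power)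
  with False show ?thesis by (auto simp: cong_iff_dvd_diff dvd_diff_commute)
qed

text \<open>The zero-sum condition costs degree 2(p - 1). The weight \<open>h\<close> serves the
  degree count, while its residue \<open>h'\<close> supplies the coefficients; \<open>T\<close> must
  contain all sizes where \<open>h'\<close> is nonzero.\<close>

lemma weighted_zsets_cong_0:
  assumes p: "prime p" and J: "finite J"
    and deg: "sf_degree J d (\<lambda>I. h (card I))" "d + 2 * (p - 1) < card J"
    and h: "\<And>s. [h s = h' s] (mod int p)"
    and T: "finite T" "\<And>s. s \<le> card J \<Longrightarrow> h' s \<noteq> 0 \<Longrightarrow> s \<in> T"
  shows "int p dvd (\<Sum>s\<in>T. (- 1) ^ s * h' s * int (card (zsets p a b J s)))"
proof -
  let ?w = "\<lambda>I. (1 - sum a I ^ (p - 1)) * (1 - sum b I ^ (p - 1))"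
  have lin: "sf_degree J (p - 1) (\<lambda>I. 1 - sum f I ^ (p - 1))" for f
    using sf_degree_power[OF sf_degree_set_sum[OF J, of f], of "p - 1"]
    by (intro sf_degree_diff sf_degree_const) simp
  have deg': "sf_degree J (p - 1 + (p - 1) + d) (\<lambda>I. ?w I * h (card I))"
    using lin by (intro sf_degree_mult deg(1))
  have "(\<Sum>I\<in>Pow J. (- 1) ^ card I * (?w I * h (card I))) = 0"
    by (rule alternating_sum_eq_0[OF deg' J]) (use deg(2) in simp)
  moreover have "[(\<Sum>I\<in>Pow J. (- 1) ^ card I * (?w I * h (card I))) =
      (\<Sum>I\<in>Pow J. (- 1) ^ card I * (of_bool (zsum_mod p a b I) * h' (card I)))] (mod int p)"
  proof (intro cong_sum cong_mult cong_refl h)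
    fix I
    show "[?w I = of_bool (zsum_mod p a b I)] (mod int p)"
      using cong_mult[OF fermat_indicator[OF p, of "sum a I"] fermat_indicator[OF p, of "sum b I"]]
      by (simp add: zsum_mod_def of_bool_conj)
  qed
  moreover have "(\<Sum>I\<in>Pow J. (- 1) ^ card I * (of_bool (zsum_mod p a b I) * h' (card I))) =
      (\<Sum>s\<in>T. (- 1) ^ s * h' s * int (card (zsets p a b J s)))"
  proof -
    let ?g = "\<lambda>I. (- 1) ^ card I * (of_bool (zsum_mod p a b I) * h' (card I))"
    have "sum ?g (Pow J) = sum ?g {I \<in> Pow J. card I \<in> T}"
      using J T(2) by (intro sum.mono_neutral_right) (auto intro: card_mono)
    also have "\<dots> = (\<Sum>s\<in>T. \<Sum>I\<in>{I \<in> {I \<in> Pow J. card I \<in> T}. card I = s}. ?g I)"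
      using J T(1) by (intro sum.group[symmetric]) auto
    also have "\<dots> = (\<Sum>s\<in>T. (- 1) ^ s * h' s * int (card (zsets p a b J s)))"
    proof (rule sum.cong[OF refl])
      fix s assume s: "s \<in> T"
      have "(\<Sum>I\<in>{I \<in> {I \<in> Pow J. card I \<in> T}. card I = s}. ?g I)
        = (\<Sum>I\<in>zsets p a b J s. (- 1) ^ s * h' s)"
        using s J by (intro sum.mono_neutral_cong_right) (auto simp: zsets_def)
      then show "(\<Sum>I\<in>{I \<in> {I \<in> Pow J. card I \<in> T}. card I = s}. ?g I)
        = (- 1) ^ s * h' s * int (card (zsets p a b J s))" by simp
    qed
    finally show ?thesis .
  qed
  ultimately show ?thesis by (metis cong_0_iff cong_sym)
qed

text \<open>A case of Lucas's theorem. In Vandermonde's identity p divides \<open>p choose k\<close>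
  unless k is 0 or p, so replacing s by s - p lowers the coefficient by 1 modulo p.\<close>

lemma choose_prime_mod:
  assumes p: "prime p"
  shows "[int (s choose p) = int (s div p)] (mod int p)"
proof (induction s rule: less_induct)
  case (less s)
  have p0: "p > 0" using prime_gt_0_nat[OF p] .
  show ?case
  proof (cases "s < p")
    case True
    then show ?thesis by (simp add: binomial_eq_0)
  next
    case False
    define r where "r = s - p"
    have s: "s = p + r" using False by (simp add: r_def)
    have "(s choose p) = (\<Sum>k\<le>p. (p choose k) * (r choose (p - k)))"
      using vandermonde[of p r p] s by simp
    also have "int \<dots> = (\<Sum>k\<le>p. int ((p choose k) * (r choose (p - k))))"
      by simp
    also have "[\<dots> = (\<Sum>k\<le>p. if k = 0 then int (r choose p) else if k = p then 1 else 0)] (mod int p)"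
    proof (rule cong_sum)
      fix k assume "k \<in> {..p}"
      then show "[int ((p choose k) * (r choose (p - k))) =
          (if k = 0 then int (r choose p) else if k = p then 1 else 0)] (mod int p)"
        using dvd_choose_prime[of k p] p p0
        by (auto simp: cong_0_iff simp del: of_nat_mult)
    qed
    also have "(\<Sum>k\<le>p. if k = 0 then int (r choose p) else if k = p then 1 else 0) = int (r choose p) + 1"
    proof -
      have "(\<Sum>k\<le>p. if k = 0 then int (r choose p) else if k = p then 1 else 0)
          = (\<Sum>k\<in>{0,p}. if k = 0 then int (r choose p) else if k = p then 1 else 0)"
        by (rule sum.mono_neutral_right) auto
      then show ?thesis using p0 by simp
    qed
    also have "[int (r choose p) + 1 = int (r div p) + 1] (mod int p)"
      using s p0 by (intro cong_add less.IH cong_refl) simp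
    also have "int (r div p) + 1 = int (s div p)"
      using s p0 by simp
    finally show ?thesis .
  qed
qed

section \<open>Reiher's argument for a single prime\<close>

lemma zsets_0: "card (zsets n a b J 0) = 1" if "finite J"
proof -
  have "zsets n a b J 0 = {{}}"
    using that by (auto simp: zsets_def zsum_mod_def dest: finite_subset)
  then show ?thesis by simp
qed

lemma zsets_mono: "I \<subseteq> J \<Longrightarrow> zsets n a b I s \<subseteq> zsets n a b J s"
  by (auto simp: zsets_def)

lemma zsum_mod_Un:
  "finite I \<Longrightarrow> finite K \<Longrightarrow> I \<inter> K = {} \<Longrightarrow> zsum_mod n a b I \<Longrightarrow> zsum_mod n a b K \<Longrightarrow> zsum_mod n a b (I \<union> K)"
  by (simp add: zsum_mod_def sum.union_disjoint)

lemma zsum_mod_Diff: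
  "finite J \<Longrightarrow> I \<subseteq> J \<Longrightarrow> zsum_mod n a b J \<Longrightarrow> zsum_mod n a b I \<Longrightarrow> zsum_mod n a b (J - I)"
  by (simp add: zsum_mod_def sum_diff)

lemma dvd_less_4:
  assumes "s < 4 * p" "p dvd (s::nat)"
  shows "s \<in> {0, p, 2 * p, 3 * p}"
proof -
  obtain j where j: "s = p * j" using assms by (elim dvdE)
  then have "j < 4" using assms by (simp add: mult.commute)
  then have "j \<in> {0, 1, 2, 3}" by auto
  then show ?thesis using j by (auto simp: mult.commute)
qed

text \<open>The weight is the Fermat indicator of \<open>p dvd s + r\<close>. With the two
  coordinates the total degree is 3p - 3, just below the required size 3p - 2.\<close>

lemma zsets_cong_0:
  assumes p: "prime p" and J: "finite J" and c: "3 * p - 2 \<le> card J"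
    and T: "finite T" "\<And>s. s \<le> card J \<Longrightarrow> p dvd s + r \<Longrightarrow> s \<in> T"
  shows "int p dvd (\<Sum>s\<in>T. (- 1) ^ s * of_bool (p dvd s + r) * int (card (zsets p a b J s)))"
proof (rule weighted_zsets_cong_0[OF p J])
  have "sf_degree J 1 (\<lambda>I. int (card I) + int r)"
    by (intro sf_degree.add sf_degree_card sf_degree_const J)
  from sf_degree_power[OF this, of "p - 1"]
  show "sf_degree J (p - 1) (\<lambda>I. 1 - int (card I + r) ^ (p - 1))"
    by (intro sf_degree_diff sf_degree_const) simp
  show "[1 - int (s + r) ^ (p - 1) = of_bool (p dvd s + r)] (mod int p)" for s
    using fermat_indicator[OF p, of "int (s + r)"] by (simp only: int_dvd_int_iff)
  show "p - 1 + 2 * (p - 1) < card J"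
    using c prime_gt_1_nat[OF p] by simp
qed (use T in auto)

text \<open>The only multiples of p below 3p are 0, p and 2p. The empty set contributes 1 to the
  congruence, so the other two counts cannot both vanish.\<close>

lemma exists_zset_p_or_2p:
  assumes p: "prime p" and J: "finite J" and c: "card J = 3 * p - 2"
  shows "zsets p a b J p \<noteq> {} \<or> zsets p a b J (2 * p) \<noteq> {}"
proof (rule ccontr)
  assume *: "\<not> ?thesis"
  have p1: "p > 1" using prime_gt_1_nat[OF p] .
  have "int p dvd (\<Sum>s\<in>{0, p, 2 * p}. (- 1) ^ s * of_bool (p dvd s + 0) * int (card (zsets p a b J s)))"
  proof (rule zsets_cong_0[OF p J])
    fix s assume s: "s \<le> card J" "p dvd s + 0"
    then have "s < 3 * p" using c p1 by auto
    then show "s \<in> {0, p, 2 * p}" using dvd_less_4[of s p] s by auto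
  qed (use c in auto)
  then show False using * p1 by (simp add: zsets_0[OF J])
qed

text \<open>For odd p the signs at 0, p, 2p are +, -, +. Both cardinalities occur in the double
  count: 3p - 2 for the complement of the small set, 3p - 1 for the union.\<close>

lemma zsets_2p_cong:
  assumes p: "prime p" "odd p" and J: "finite J" and c: "card J = 3 * p - 2 \<or> card J = 3 * p - 1"
    and z: "zsets p a b J p = {}"
  shows "int p dvd 1 + int (card (zsets p a b J (2 * p)))"
proof -
  have p1: "p > 1" using prime_gt_1_nat[OF p(1)] .
  have "int p dvd (\<Sum>s\<in>{0, p, 2 * p}. (- 1) ^ s * of_bool (p dvd s + 0) * int (card (zsets p a b J s)))"
  proof (rule zsets_cong_0[OF p(1) J])
    fix s assume s: "s \<le> card J" "p dvd s + 0"
    then have "s < 3 * p" using c p1 by auto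
    then show "s \<in> {0, p, 2 * p}" using dvd_less_4[of s p] s by auto
  qed (use c in auto)
  then show ?thesis using z p1 by (simp add: zsets_0[OF J])
qed

text \<open>Any 3p - 2 elements of a zero-sum set of size 3p contain a zero-sum set of size p or 2p;
  in the second case its complement in the large set has size p.\<close>

lemma zsets_3p_imp_zsets_p:
  assumes p: "prime p" and J: "finite J" and z: "zsets p a b J (3 * p) \<noteq> {}"
  shows "zsets p a b J p \<noteq> {}"
proof -
  have p1: "p > 1" using prime_gt_1_nat[OF p] .
  obtain D where D: "D \<subseteq> J" "card D = 3 * p" "zsum_mod p a b D"
    using z by (auto simp: zsets_def)
  have fD: "finite D" using D J finite_subset by blast
  obtain E where E: "E \<subseteq> D" "card E = 3 * p - 2"
    using obtain_subset_with_card_n[of "3 * p - 2" D] D(2) by auto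
  have fE: "finite E" using E fD finite_subset by blast
  from exists_zset_p_or_2p[OF p fE E(2)] show ?thesis
  proof
    assume "zsets p a b E p \<noteq> {}"
    then show ?thesis using zsets_mono[of E J] E D by blast
  next
    assume "zsets p a b E (2 * p) \<noteq> {}"
    then obtain C where C: "C \<subseteq> E" "card C = 2 * p" "zsum_mod p a b C" by (auto simp: zsets_def)
    then have "D - C \<in> zsets p a b J p"
      using E D fD zsum_mod_Diff[of D C] by (auto simp: zsets_def card_Diff_subset finite_subset)
    then show ?thesis by blast
  qed
qed

text \<open>
  Reiher's double count of the pairs of disjoint zero-sum sets of sizes \<open>p - 1\<close> and \<open>2p\<close>:
  the witness \<open>x\<close> is their number, organised once by the small set and once by the union.
\<close>
lemma zsets_p_minus_1_cong:
  assumes p: "prime p" "odd p" and J: "finite J" and c: "card J = 4 * p - 3"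
    and z: "zsets p a b J p = {}"
  shows "\<exists>x. int p dvd x + int (card (zsets p a b J (p - 1)))
           \<and> int p dvd x + int (card (zsets p a b J (3 * p - 1)))"
proof -
  have p1: "p > 1" using prime_gt_1_nat[OF p(1)] .
  define X where "X = (SIGMA A : zsets p a b J (p - 1). zsets p a b (J - A) (2 * p))"
  define Y where "Y = (SIGMA D : zsets p a b J (3 * p - 1). zsets p a b D (2 * p))"
  have fin: "I \<subseteq> J \<Longrightarrow> finite I" for I using J finite_subset by blast
  have z': "I \<subseteq> J \<Longrightarrow> zsets p a b I p = {}" for I using z zsets_mono by blast
  have X: "int (card X) = (\<Sum>A\<in>zsets p a b J (p - 1). int (card (zsets p a b (J - A) (2 * p))))"
    unfolding X_def using J by (subst card_SigmaI) (auto simp: finite_zsets)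
  have Y: "int (card Y) = (\<Sum>D\<in>zsets p a b J (3 * p - 1). int (card (zsets p a b D (2 * p))))"
    unfolding Y_def using J fin by (subst card_SigmaI) (auto simp: finite_zsets zsets_def)
  have "int p dvd (\<Sum>A\<in>zsets p a b J (p - 1). 1 + int (card (zsets p a b (J - A) (2 * p))))"
  proof (rule dvd_sum)
    fix A assume "A \<in> zsets p a b J (p - 1)"
    then have A: "A \<subseteq> J" "card A = p - 1" by (auto simp: zsets_def)
    show "int p dvd 1 + int (card (zsets p a b (J - A) (2 * p)))"
      using p A c p1 fin z' J by (intro zsets_2p_cong) (auto simp: card_Diff_subset)
  qed
  then have 1: "int p dvd int (card X) + int (card (zsets p a b J (p - 1)))"
    by (simp add: X sum.distrib add.commute)
  have "int p dvd (\<Sum>D\<in>zsets p a b J (3 * p - 1). 1 + int (card (zsets p a b D (2 * p))))"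
  proof (rule dvd_sum)
    fix D assume "D \<in> zsets p a b J (3 * p - 1)"
    then have D: "D \<subseteq> J" "card D = 3 * p - 1" by (auto simp: zsets_def)
    show "int p dvd 1 + int (card (zsets p a b D (2 * p)))"
      using p D fin z' by (intro zsets_2p_cong) auto
  qed
  then have 2: "int p dvd int (card Y) + int (card (zsets p a b J (3 * p - 1)))"
    by (simp add: Y sum.distrib add.commute)
  have "bij_betw (\<lambda>(A, C). (A \<union> C, C)) X Y"
  proof (rule bij_betw_byWitness[where f' = "\<lambda>(D, C). (D - C, C)"])
    show "\<forall>x\<in>X. (case case x of (A, C) \<Rightarrow> (A \<union> C, C) of (D, C) \<Rightarrow> (D - C, C)) = x"
      by (auto simp: X_def zsets_def)
    show "\<forall>y\<in>Y. (case case y of (D, C) \<Rightarrow> (D - C, C) of (A, C) \<Rightarrow> (A \<union> C, C)) = y"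
      by (auto simp: Y_def zsets_def)
    show "(\<lambda>(A, C). (A \<union> C, C)) ` X \<subseteq> Y"
    proof clarify
      fix A C assume "(A, C) \<in> X"
      then have *: "A \<subseteq> J" "card A = p - 1" "zsum_mod p a b A" "C \<subseteq> J - A" "card C = 2 * p" "zsum_mod p a b C"
        by (auto simp: X_def zsets_def)
      then have "A \<inter> C = {}" "finite A" "finite C" using fin[of A] fin[of C] by auto
      with * have "card (A \<union> C) = 3 * p - 1" "zsum_mod p a b (A \<union> C)"
        using p1 by (auto simp: card_Un_disjoint intro!: zsum_mod_Un)
      then show "(A \<union> C, C) \<in> Y" using * by (auto simp: Y_def zsets_def)
    qed
    show "(\<lambda>(D, C). (D - C, C)) ` Y \<subseteq> X"
    proof clarify
      fix D C assume "(D, C) \<in> Y"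
      then have *: "D \<subseteq> J" "card D = 3 * p - 1" "zsum_mod p a b D" "C \<subseteq> D" "card C = 2 * p" "zsum_mod p a b C"
        by (auto simp: Y_def zsets_def)
      then have "card (D - C) = p - 1" "zsum_mod p a b (D - C)"
        using fin[of D] fin[of C] by (auto simp: card_Diff_subset intro!: zsum_mod_Diff)
      then show "(D - C, C) \<in> X" using * by (auto simp: X_def zsets_def)
    qed
  qed
  then have "card X = card Y" by (rule bij_betw_same_card)
  with 1 2 show ?thesis by metis
qed

text \<open>Without a zero-sum set of size p, the alternating sums and the double count give linear
  relations between the counts at 2p, p - 1, 2p - 1 and 3p - 1 that force p to divide 2.\<close>

lemma exists_zset_odd_prime:
  assumes p: "prime p" "odd p" and J: "finite J" and c: "card J = 4 * p - 3"
  shows "zsets p a b J p \<noteq> {}"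
proof
  assume z: "zsets p a b J p = {}"
  have p2: "p > 2" using prime_ge_2_nat[OF p(1)] p(2) by (metis even_numeral le_neq_implies_less)
  let ?N = "\<lambda>s. int (card (zsets p a b J s))"
  have N0: "?N 0 = 1" using zsets_0[OF J] by simp
  have Np: "?N p = 0" using z by simp
  have "zsets p a b J (3 * p) = {}" using zsets_3p_imp_zsets_p[OF p(1) J] z by blast
  then have N3p: "?N (3 * p) = 0" by simp
  have less: "s \<le> card J \<Longrightarrow> s + 1 < 4 * p" for s using c p2 by simp
  have pd: "\<not> p dvd 1" using p2 by simp
  \<comment> \<open>The sizes congruent to -1 modulo p; the next one, 4p - 1, exceeds
    \<open>card J\<close>.\<close>
  define q1 q2 q3 where q: "q1 = p - 1" "q2 = 2 * p - 1" "q3 = 3 * p - 1"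
  have ev: "even q1" "even q3" "odd q2" using p q by auto
  have S: "s + 1 \<in> {0, p, 2 * p, 3 * p} \<Longrightarrow> s \<in> {q1, q2, q3}" for s
    using q by auto
  have dv: "p dvd q1 + 1" "p dvd q2 + 1" "p dvd q3 + 1"
    using p2 q by simp_all
  have ndv: "\<not> p dvd q1" "\<not> p dvd q2" "\<not> p dvd q3"
    using dv pd dvd_add_right_iff by blast+
  have ndv': "\<not> p dvd Suc 0" "\<not> p dvd p + 1" "\<not> p dvd 2 * p + 1" "\<not> p dvd 3 * p + 1"
    using pd dvd_add_right_iff[of p p 1] dvd_add_right_iff[of p "2 * p" 1]
      dvd_add_right_iff[of p "3 * p" 1] by simp_all
  obtain x where x: "int p dvd x + ?N q1" "int p dvd x + ?N q3"
    using zsets_p_minus_1_cong[OF p J c z] q by blast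
  have dist: "distinct [0, p, 2 * p, 3 * p, q1, q2, q3]"
    using p2 q by auto
  have "int p dvd (\<Sum>s\<in>{0, p, 2 * p, 3 * p}. (- 1) ^ s * of_bool (p dvd s + 0) * ?N s)"
  proof (rule zsets_cong_0[OF p(1) J])
    fix s assume "s \<le> card J" "p dvd s + 0"
    then show "s \<in> {0, p, 2 * p, 3 * p}" using dvd_less_4[of s p] less[of s] by simp
  qed (use c in auto)
  then have 1: "int p dvd 1 + ?N (2 * p)"
    using p2 N0 Np N3p by simp
  have "int p dvd (\<Sum>s\<in>{q1, q2, q3}. (- 1) ^ s * of_bool (p dvd s + 1) * ?N s)"
  proof (rule zsets_cong_0[OF p(1) J])
    fix s assume "s \<le> card J" "p dvd s + 1"
    then show "s \<in> {q1, q2, q3}" using dvd_less_4[of "s + 1" p] less[of s] S by blast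
  qed (use c in auto)
  then have 2: "int p dvd ?N q1 - ?N q2 + ?N q3"
    using dist ev dv by (simp add: algebra_simps)
  let ?T = "{0, p, 2 * p, 3 * p, q1, q2, q3}"
  \<comment> \<open>The first factor of \<open>?h\<close> tests \<open>s \<equiv> 0\<close> against \<open>s \<equiv> -1\<close> modulo \<open>p\<close> with a polynomial of degree
    only \<open>p - 2\<close>, which leaves room for a second factor of degree \<open>p\<close>; that one
    is \<open>s div p - 3\<close> modulo \<open>p\<close> and replaces Reiher's averaging over all subsets
    of size \<open>3p - 3\<close>.\<close>
  let ?h = "\<lambda>s. ((int s + 1) ^ (p - 1) - int s ^ (p - 1)) * (int (s choose p) - 3)"
  define h' where "h' s = (of_bool (p dvd s) - of_bool (p dvd s + 1)) * (int (s div p) - 3)" for s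
  have "int p dvd (\<Sum>s\<in>?T. (- 1) ^ s * h' s * ?N s)"
  proof (rule weighted_zsets_cong_0[OF p(1) J])
    have "Suc (p - 2) = p - 1" using p2 by simp
    then have "sf_degree J (p - 2) (\<lambda>I. (int (card I) + 1) ^ (p - 1) - int (card I) ^ (p - 1))"
      using sf_degree_power_step[OF sf_degree_card[OF J], of "p - 2"] by simp
    then show "sf_degree J (p - 2 + p) (\<lambda>I. ?h (card I))"
      by (intro sf_degree_mult sf_degree_diff[OF sf_degree_card_choose sf_degree_const] J)
    show "[?h s = h' s] (mod int p)" for s
      unfolding h'_def
    proof (rule cong_mult[OF _ cong_diff[OF choose_prime_mod[OF p(1)] cong_refl]])
      have "[(1 - int s ^ (p - 1)) - (1 - int (s + 1) ^ (p - 1)) =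
          of_bool (int p dvd int s) - of_bool (int p dvd int (s + 1))] (mod int p)"
        by (intro cong_diff fermat_indicator p)
      then show "[(int s + 1) ^ (p - 1) - int s ^ (p - 1) = of_bool (p dvd s) - of_bool (p dvd s + 1)] (mod int p)"
        unfolding int_dvd_int_iff by (simp add: add.commute)
    qed
    \<comment> \<open>The total degree is 4p - 4, exactly one below \<open>card J\<close>.\<close>
    show "p - 2 + p + 2 * (p - 1) < card J" using c p2 by simp
    fix s assume s: "s \<le> card J" "h' s \<noteq> 0"
    then have "p dvd s \<or> p dvd s + 1" by (auto simp: h'_def)
    then show "s \<in> ?T"
      using dvd_less_4[of "s + 1" p] dvd_less_4[of s p] less[OF s(1)] S[of s] by auto
  qed simp
  moreover have "q1 div p = 0" "q2 div p = 1" "q3 div p = 2"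
    using p2 q by (auto intro!: div_nat_eqI)
  then have "h' 0 = - 3" "h' p = - 2" "h' (2 * p) = - 1" "h' (3 * p) = 0"
      "h' q1 = 3" "h' q2 = 2" "h' q3 = 1"
    using p2 dv ndv ndv' by (simp_all add: h'_def)
  ultimately have 3: "int p dvd - 3 - ?N (2 * p) + 3 * ?N q1 - 2 * ?N q2 + ?N q3"
    using dist ev N0 Np N3p p(2) by (simp add: algebra_simps)
  \<comment> \<open>All counts and \<open>x\<close> cancel, and the constants leave -3 + 1 =
    -2.\<close>
  have "int p dvd (- 3 - ?N (2 * p) + 3 * ?N q1 - 2 * ?N q2 + ?N q3)
      + (1 + ?N (2 * p)) - 2 * (?N q1 - ?N q2 + ?N q3)
      - ((x + ?N q1) - (x + ?N q3))"
    by (intro dvd_add dvd_diff dvd_mult 1 2 3 x)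
  then have "int p dvd 2" by simp
  then show False using p2 by (auto dest: zdvd_imp_le)
qed

subsection \<open>Multiplicativity and Reiher's theorem\<close>

text \<open>The ordinary bound, for arbitrary sequences. Indexing keeps repeated terms apart and
  makes subsequences subsets; integer values allow block sums to be divided.\<close>

definition egz_index_bound :: "nat \<Rightarrow> nat \<Rightarrow> nat \<Rightarrow> bool" where
  "egz_index_bound n L l \<longleftrightarrow>
     (\<forall>(J :: nat set) a b. finite J \<longrightarrow> l \<le> card J \<longrightarrow> zsets n a b J L \<noteq> {})"

lemma egz_index_boundD:
  fixes J :: "nat set"
  assumes "egz_index_bound n L l" "finite J" "l \<le> card J"
  obtains I where "I \<subseteq> J" "card I = L" "zsum_mod n a b I"
  using assms unfolding egz_index_bound_def zsets_def by blast

lemma egz_index_boundI: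
  assumes "\<And>(J :: nat set) a b. finite J \<Longrightarrow> card J = l \<Longrightarrow> zsets n a b J L \<noteq> {}"
  shows "egz_index_bound n L l"
  unfolding egz_index_bound_def
proof (intro allI impI)
  fix J :: "nat set" and a b :: "nat \<Rightarrow> int"
  assume J: "finite J" "l \<le> card J"
  then obtain I where I: "I \<subseteq> J" "card I = l" by (meson obtain_subset_with_card_n)
  with assms[of I a b] J zsets_mono[OF I(1)] show "zsets n a b J L \<noteq> {}"
    using finite_subset by blast
qed

text \<open>Greedy extraction: when the last block is chosen, m(l - 1) elements are used and r must
  remain, which the hypothesis expresses without subtraction.\<close>

lemma disjoint_zsum_blocks:
  fixes J :: "nat set"
  assumes bound: "egz_index_bound m m r" and J: "finite J" and c: "m * l + r \<le> card J + m"
  shows "\<exists>B. (\<forall>i<l. B i \<in> zsets m a b J m) \<and> disjoint_family_on B {..<l}"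
  using c
proof (induction l)
  case 0
  show ?case by (simp add: disjoint_family_on_def)
next
  case (Suc l)
  then obtain B where B: "\<And>i. i < l \<Longrightarrow> B i \<in> zsets m a b J m" "disjoint_family_on B {..<l}"
    by auto
  let ?U = "\<Union>i<l. B i"
  have fin: "finite (B i)" "card (B i) = m" if "i < l" for i
    using B(1)[OF that] J by (auto simp: zsets_def finite_subset)
  have "card ?U = (\<Sum>i<l. card (B i))"
    using fin B(2) by (intro card_UN_disjoint) (auto simp: disjoint_family_on_def)
  then have "card ?U = m * l" using fin by simp
  moreover have "?U \<subseteq> J" using B(1) by (auto simp: zsets_def)
  ultimately have "r \<le> card (J - ?U)"
    using Suc.prems J by (simp add: card_Diff_subset finite_subset)
  then obtain I where I: "I \<subseteq> J - ?U" "card I = m" "zsum_mod m a b I"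
    using egz_index_boundD[OF bound, of "J - ?U" a b] J by auto
  have "\<forall>i<Suc l. (B(l := I)) i \<in> zsets m a b J m"
    using I B(1) by (auto simp: zsets_def less_Suc_eq)
  moreover have "disjoint_family_on (B(l := I)) {..<Suc l}"
    using I(1) B(2) by (auto simp: disjoint_family_on_def less_Suc_eq) blast+
  ultimately show ?case by blast
qed

text \<open>Each block acts as one term, its sum divided by \<open>m\<close>. If the quotients of
  \<open>L\<close> blocks sum to 0 modulo \<open>q\<close>, the union of these blocks has sum 0
  modulo \<open>m * q\<close>. The size \<open>s\<close> is m(l - 1) + r.\<close>

lemma egz_index_bound_mult:
  assumes m: "egz_index_bound m m r" and q: "egz_index_bound q L l" and m0: "m > 0"
    and s: "s + m = m * l + r"
  shows "egz_index_bound (m * q) (m * L) s"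
proof (rule egz_index_boundI)
  fix J :: "nat set" and a b :: "nat \<Rightarrow> int"
  assume J: "finite J" "card J = s"
  obtain B where B: "\<And>i. i < l \<Longrightarrow> B i \<in> zsets m a b J m" and dis: "disjoint_family_on B {..<l}"
    using disjoint_zsum_blocks[OF m J(1), of l a b] s J(2) by auto
  have fin: "finite (B i)" "card (B i) = m" "int m dvd sum a (B i)" "int m dvd sum b (B i)" if "i < l" for i
    using B[OF that] J by (auto simp: zsets_def zsum_mod_def finite_subset)
  have "l \<le> card {..<l}" by simp
  with finite_lessThan obtain I where I: "I \<subseteq> {..<l}" "card I = L"
      "zsum_mod q (\<lambda>i. sum a (B i) div int m) (\<lambda>i. sum b (B i) div int m) I"
    by (rule egz_index_boundD[OF q])
  let ?U = "\<Union>i\<in>I. B i"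
  have fI: "finite I" using I(1) finite_subset by blast
  have dis': "\<forall>i\<in>I. \<forall>j\<in>I. i \<noteq> j \<longrightarrow> B i \<inter> B j = {}"
    using dis I(1) by (auto simp: disjoint_family_on_def)
  have sum_U: "sum f ?U = (\<Sum>i\<in>I. sum f (B i))" for f :: "nat \<Rightarrow> int"
    using fin(1) I(1) dis' fI by (intro sum.UNION_disjoint) auto
  have "card ?U = (\<Sum>i\<in>I. card (B i))"
    using fin(1) I(1) dis' fI by (intro card_UN_disjoint) auto
  also have "\<dots> = m * L"
    using fin(2) I by (simp add: subset_iff mult.commute)
  finally have "card ?U = m * L" .
  moreover have "?U \<subseteq> J" using B I(1) by (auto simp: zsets_def)
  moreover have "int (m * q) dvd sum f ?U"
    if "\<And>i. i < l \<Longrightarrow> int m dvd sum f (B i)" "int q dvd (\<Sum>i\<in>I. sum f (B i) div int m)" for f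
  proof -
    have "sum f ?U = (\<Sum>i\<in>I. int m * (sum f (B i) div int m))"
      unfolding sum_U using that(1) I(1) by (intro sum.cong) auto
    also have "\<dots> = int m * (\<Sum>i\<in>I. sum f (B i) div int m)"
      by (simp add: sum_distrib_left)
    finally show ?thesis using that(2) by (simp add: mult_dvd_mono)
  qed
  ultimately show "zsets (m * q) a b J (m * L) \<noteq> {}"
    using fin(3,4) I(3) by (auto simp: zsets_def zsum_mod_def)
qed

text \<open>Pigeonhole on the four parity classes settles the one even prime.\<close>

lemma egz_index_bound_2: "egz_index_bound 2 2 5"
proof (rule egz_index_boundI)
  fix J :: "nat set" and a b :: "nat \<Rightarrow> int"
  assume J: "finite J" "card J = 5"
  let ?f = "\<lambda>i. (even (a i), even (b i))"
  have "card (?f ` J) \<le> card (UNIV :: (bool \<times> bool) set)" by (rule card_mono) auto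
  also have "\<dots> < card J" using J by (simp add: UNIV_bool flip: UNIV_Times_UNIV)
  finally have "\<not> inj_on ?f J" by (rule pigeonhole)
  then obtain i j where "i \<in> J" "j \<in> J" "i \<noteq> j" "?f i = ?f j"
    by (auto simp: inj_on_def)
  then have "{i, j} \<in> zsets 2 a b J 2" by (auto simp: zsets_def zsum_mod_def)
  then show "zsets 2 a b J 2 \<noteq> {}" by blast
qed

text \<open>Multiplicativity reduces n to primes, since m((4p - 3) - 1) + (4m - 3) = 4mp - 3 has the
  same form again.\<close>

theorem kemnitz_reiher:
  assumes "n > 0"
  shows "egz_index_bound n n (4 * n - 3)"
  using assms
proof (induction n rule: less_induct)
  case (less n)
  show ?case
  proof (cases "n = 1")
    case True
    have "zsets 1 a b J 1 \<noteq> {}" if "card J = 1" for J :: "nat set" and a b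
      using that by (auto simp: zsets_def zsum_mod_def)
    then show ?thesis using True by (intro egz_index_boundI) auto
  next
    case False
    then obtain p where p: "prime p" "p dvd n" using prime_factor_nat by blast
    then obtain m where n: "n = m * p" by (metis dvdE mult.commute)
    have p1: "p > 1" using prime_gt_1_nat[OF p(1)] .
    have m: "m > 0" "m < n" using less.prems n p1 by auto
    have prime_case: "egz_index_bound p p (4 * p - 3)"
    proof (cases "odd p")
      case True
      then show ?thesis using p exists_zset_odd_prime by (intro egz_index_boundI) auto
    next
      case False
      then have "p = 2" using p(1) primes_dvd_imp_eq two_is_prime_nat by blast
      then show ?thesis using egz_index_bound_2 by simp
    qed
    have "4 * n - 3 + m = m * (4 * p - 3) + (4 * m - 3)"
    proof -
      obtain u v where "p = Suc u" "m = Suc v" using p1 m by (metis gr0_conv_Suc less_trans zero_less_one)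
      then show ?thesis unfolding n by (simp add: algebra_simps)
    qed
    then show ?thesis
      unfolding n using less.IH[OF m(2,1)] prime_case m(1) n
      by (intro egz_index_bound_mult) auto
  qed
qed

text \<open>Splitting off a zero-sum set of size p lowers t by 1. For t = 2 the remaining 3p - 2
  elements contain a zero-sum set of size p or 2p, and one of size p is joined to the set split
  off.\<close>

lemma egz_index_bound_prime_multiple:
  assumes p: "prime p" and t: "2 \<le> t"
  shows "egz_index_bound p (t * p) ((t + 2) * p - 2)"
  using t
proof (induction t rule: dec_induct)
  case base
  have p1: "p > 1" using prime_gt_1_nat[OF p] .
  then have kemnitz: "egz_index_bound p p (4 * p - 3)" by (intro kemnitz_reiher) simp
  show ?case
  proof (rule egz_index_boundI)
    fix J :: "nat set" and a b :: "nat \<Rightarrow> int"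
    assume J: "finite J" "card J = (2 + 2) * p - 2"
    then have "4 * p - 3 \<le> card J" by simp
    with J(1) obtain I where I: "I \<subseteq> J" "card I = p" "zsum_mod p a b I"
      by (rule egz_index_boundD[OF kemnitz])
    have fI: "finite I" using I(1) J(1) finite_subset by blast
    have c: "card (J - I) = 3 * p - 2" using I J fI by (simp add: card_Diff_subset)
    have "zsets p a b (J - I) p \<noteq> {} \<or> zsets p a b (J - I) (2 * p) \<noteq> {}"
      using c J by (intro exists_zset_p_or_2p p) auto
    then show "zsets p a b J (2 * p) \<noteq> {}"
    proof
      assume "zsets p a b (J - I) p \<noteq> {}"
      then obtain A where A: "A \<subseteq> J - I" "card A = p" "zsum_mod p a b A" by (auto simp: zsets_def)
      then have "finite A" "I \<inter> A = {}" using J finite_subset by auto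
      then have "I \<union> A \<in> zsets p a b J (2 * p)"
        using A I fI by (auto simp: zsets_def card_Un_disjoint zsum_mod_Un)
      then show ?thesis by blast
    qed (use zsets_mono[of "J - I" J] in blast)
  qed
next
  case (step t)
  have p1: "p > 1" using prime_gt_1_nat[OF p] .
  then have kemnitz: "egz_index_bound p p (4 * p - 3)" by (intro kemnitz_reiher) simp
  show ?case
  proof (rule egz_index_boundI)
    fix J :: "nat set" and a b :: "nat \<Rightarrow> int"
    assume J: "finite J" "card J = (Suc t + 2) * p - 2"
    have "2 * p \<le> t * p" using step by simp
    moreover have "card J = t * p + 3 * p - 2" using J(2) by (simp add: algebra_simps)
    ultimately have "4 * p - 3 \<le> card J" by linarith
    with J(1) obtain I where I: "I \<subseteq> J" "card I = p" "zsum_mod p a b I"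
      by (rule egz_index_boundD[OF kemnitz])
    have fI: "finite I" using I(1) J(1) finite_subset by blast
    have "(t + 2) * p - 2 \<le> card (J - I)" using I J fI by (simp add: card_Diff_subset)
    then obtain A where A: "A \<subseteq> J - I" "card A = t * p" "zsum_mod p a b A"
      using egz_index_boundD[OF step.IH, of "J - I" a b] J by auto
    then have "finite A" "I \<inter> A = {}" using J finite_subset by auto
    then have "I \<union> A \<in> zsets p a b J (Suc t * p)"
      using A I fI by (auto simp: zsets_def card_Un_disjoint zsum_mod_Un)
    then show "zsets p a b J (Suc t * p) \<noteq> {}" by blast
  qed
qed

subsection \<open>Sequences over the group\<close>

lemma foldr_Zmod_square:
  "foldr (\<otimes>\<^bsub>Zmod_square n\<^esub>) xs \<one>\<^bsub>Zmod_square n\<^esub>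
   = (sum_list (map fst xs) mod int n, sum_list (map snd xs) mod int n)"
  by (induction xs) (auto simp: mod_simps)

lemma zero_sum_Zmod_square_iff:
  assumes "n > 0"
  shows "zero_sum (Zmod_square n) xs \<longleftrightarrow>
    set xs \<subseteq> {0..<int n} \<times> {0..<int n} \<and>
    int n dvd sum_list (map fst xs) \<and> int n dvd sum_list (map snd xs)"
  unfolding zero_sum_def foldr_Zmod_square using assms
  by (auto simp: carrier_integer_mod_group dvd_eq_mod_eq_0)

lemma sum_list_nths:
  assumes "I \<subseteq> {..<length xs}"
  shows "sum_list (map f (nths xs I)) = (\<Sum>i\<in>I. f (xs ! i))"
proof -
  have "sum_list (map f (nths xs I)) = (\<Sum>i<length xs. if i \<in> I then f (xs ! i) else 0)"
  proof (induction xs rule: rev_induct)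
    case (snoc x xs)
    have "(\<Sum>i<length xs. if i \<in> I then f ((xs @ [x]) ! i) else 0) =
        (\<Sum>i<length xs. if i \<in> I then f (xs ! i) else 0)"
      by (intro sum.cong) (simp_all add: nth_append)
    with snoc show ?case by (simp add: nths_append)
  qed simp
  also have "\<dots> = (\<Sum>i\<in>I. f (xs ! i))"
    using assms by (intro sum.mono_neutral_cong_right) auto
  finally show ?thesis .
qed

lemma egz_mod_bound_Zmod_square:
  assumes "egz_index_bound n L l" "n > 0"
  shows "egz_mod_bound (Zmod_square n) L l"
  unfolding egz_mod_bound_def
proof (intro allI impI)
  fix xs :: "(int \<times> int) list"
  assume xs: "zero_sum (Zmod_square n) xs" "l \<le> length xs"
  have "l \<le> card {..<length xs}" using xs(2) by simp
  with finite_lessThan obtain I where I: "I \<subseteq> {..<length xs}" "card I = L"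
      "zsum_mod n (\<lambda>i. fst (xs ! i)) (\<lambda>i. snd (xs ! i)) I"
    by (rule egz_index_boundD[OF assms(1)])
  have eq: "{i. i < length xs \<and> i \<in> I} = I" using I(1) by auto
  have "zero_sum (Zmod_square n) (nths xs I)"
    using xs I assms(2) set_nths_subset[of xs I]
    by (auto simp: zero_sum_Zmod_square_iff sum_list_nths zsum_mod_def)
  then show "\<exists>ys. subseq ys xs \<and> length ys = L \<and> zero_sum (Zmod_square n) ys"
    using I(2) by (intro exI[of _ "nths xs I"]) (auto simp: length_nths eq subseq_conv_nths)
qed

section \<open>The extremal sequence for the lower bound\<close>

lemma subseq_replicateD:
  assumes "subseq ys (replicate k x)"
  obtains j where "j \<le> k" "ys = replicate j x"
proof
  show "length ys \<le> k" using list_emb_length[OF assms] by simp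
  have "set ys \<subseteq> set (replicate k x)"
    using assms set_nths_subset unfolding subseq_conv_nths by metis
  then show "ys = replicate (length ys) x" by (intro replicate_eqI) auto
qed

lemma no_zero_sum_subseq_example:
  fixes n L d :: nat
  assumes n: "n \<ge> 2" and L: "n dvd L" and d: "coprime n d" and dL: "3 \<le> d" "d \<le> L + 2"
  shows "\<not> egz_mod_bound (Zmod_square n) L (L + 2 * n - d)"
proof
  assume bound: "egz_mod_bound (Zmod_square n) L (L + 2 * n - d)"
  \<comment> \<open>Each coordinate of the whole sequence sums to (L + 2n - d)c + n - 1, which is
    -dc - 1 modulo n.\<close>
  obtain c where c: "[int d * c = - 1] (mod int n)"
    using cong_solve_coprime_int[of "int d" "int n"] d
    by (metis cong_minus_minus_iff coprime_commute coprime_int_iff minus_mult_right)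
  let ?m = "\<lambda>x. x mod int n"
  \<comment> \<open>The multiplicities are parameters because every subsequence has the same
    shape.\<close>
  define xs where "xs i j k = replicate i (?m c, ?m c) @ replicate j (?m (c + 1), ?m c)
     @ replicate k (?m c, ?m (c + 1))" for i j k :: nat
  have zs: "zero_sum (Zmod_square n) (xs i j k) \<longleftrightarrow>
      int n dvd int (i + j + k) * c + int j \<and> int n dvd int (i + j + k) * c + int k" for i j k
  proof -
    have "set (xs i j k) \<subseteq> {0..<int n} \<times> {0..<int n}"
      using n by (auto simp: xs_def)
    moreover have "sum_list (map fst (xs i j k)) = int i * ?m c + int j * ?m (c + 1) + int k * ?m c"
      "sum_list (map snd (xs i j k)) = int i * ?m c + int j * ?m c + int k * ?m (c + 1)"
      by (simp_all add: xs_def sum_list_replicate)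
    moreover have "[int i * ?m c + int j * ?m (c + 1) + int k * ?m c =
        int i * c + int j * (c + 1) + int k * c] (mod int n)"
      "[int i * ?m c + int j * ?m c + int k * ?m (c + 1) =
        int i * c + int j * c + int k * (c + 1)] (mod int n)"
      by (intro cong_add cong_mult cong_refl; simp add: cong_def)+
    ultimately show ?thesis
      using n by (simp add: zero_sum_Zmod_square_iff cong_dvd_iff algebra_simps)
  qed
  let ?zs = "xs (L + 2 - d) (n - 1) (n - 1)"
  have "int (L + 2 - d + (n - 1) + (n - 1)) = int L + 2 * int n - int d"
    using n dL by simp
  then have "int (L + 2 - d + (n - 1) + (n - 1)) * c + int (n - 1)
      = int L * c + int n * (2 * c + 1) - (int d * c - (- 1))"
    using n by (simp only: of_nat_diff) (simp add: algebra_simps)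
  moreover have "int n dvd int d * c - (- 1)" using c by (simp only: cong_iff_dvd_diff)
  then have "int n dvd int L * c + int n * (2 * c + 1) - (int d * c - (- 1))"
    using L by (intro dvd_diff[OF dvd_add]) simp_all
  ultimately have "zero_sum (Zmod_square n) ?zs"
    by (simp only: zs simp_thms)
  moreover have "L + 2 * n - d \<le> length ?zs" using n dL by (simp add: xs_def)
  ultimately obtain ys where ys: "subseq ys ?zs" "length ys = L" "zero_sum (Zmod_square n) ys"
    using bound unfolding egz_mod_bound_def by blast
  obtain i j k where ijk: "i \<le> L + 2 - d" "j \<le> n - 1" "k \<le> n - 1" and ys_eq: "ys = xs i j k"
    using ys(1) unfolding xs_def by (elim subseq_appendE subseq_replicateD) auto
  have len: "i + j + k = L" using ys(2) by (simp add: ys_eq xs_def)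
  have "int n dvd int L * c + int j" "int n dvd int L * c + int k"
    using ys(3) unfolding ys_eq zs len by simp_all
  moreover have "int n dvd int L * c" using L by simp
  ultimately have "n dvd j" "n dvd k" by (simp_all add: dvd_add_right_iff)
  \<comment> \<open>Both are multiples of n below n. Hence \<open>ys\<close> would be L copies of
    the first element, of which only L + 2 - d < L exist.\<close>
  then have "j = 0" "k = 0" using ijk n by (auto dest: dvd_imp_le)
  then show False using len ijk dL by simp
qed

section \<open>Assembly of the two bounds\<close>

lemma egz_mod_bound_mono: "egz_mod_bound G L l \<Longrightarrow> l \<le> l' \<Longrightarrow> egz_mod_bound G L l'"
  unfolding egz_mod_bound_def by (meson le_trans)

theorem theorem1p6:
  fixes t n p m k :: nat
  assumes "t \<ge> 2" and "n \<ge> 2"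
    and "prime p" and "n = p * m"
    and "k = (LEAST j. j \<ge> 3 \<and> gcd n j = 1)"
  shows "(int t + 2) * int n - int k + 1 \<le> int (egz_mod (Zmod_square n) (n * t))
       \<and> int (egz_mod (Zmod_square n) (n * t)) \<le> (int t + 2) * int n + int m - 3"
proof
  have m: "m > 0" using assms(2,4) by (cases m) auto
  have p2: "p \<ge> 2" using prime_ge_2_nat[OF assms(3)] .
  \<comment> \<open>The witness n + 1 also bounds k, which gives the condition
    \<open>k \<le> n * t + 2\<close> of the example.\<close>
  have ex: "n + 1 \<ge> 3 \<and> gcd n (n + 1) = 1" using assms(2) by simp
  have "k \<ge> 3 \<and> gcd n k = 1" "k \<le> n + 1"
    unfolding assms(5) using LeastI[of "\<lambda>j. j \<ge> 3 \<and> gcd n j = 1", OF ex]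
      Least_le[of "\<lambda>j. j \<ge> 3 \<and> gcd n j = 1", OF ex] by blast+
  then have k: "k \<ge> 3" "coprime n k" "k \<le> n + 1"
    by (simp_all add: coprime_iff_gcd_eq_1)
  have nt: "2 * n \<le> n * t" using assms(1) by simp
  have "egz_mod_bound (Zmod_square n) (n * t) (egz_mod (Zmod_square n) (n * t))"
    unfolding egz_mod_def using egz_mod_bound_exists_Zmod_square[of n t] assms(2) by (auto intro: LeastI_ex)
  moreover have "\<not> egz_mod_bound (Zmod_square n) (n * t) (n * t + 2 * n - k)"
    using no_zero_sum_subseq_example[of n "n * t" k] assms(2) k nt by simp
  \<comment> \<open>Bounds are upward closed, so failure at this length puts the minimum strictly
    above it; this is the + 1 of the claim.\<close>
  ultimately have "n * t + 2 * n - k < egz_mod (Zmod_square n) (n * t)"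
    using egz_mod_bound_mono not_le_imp_less by blast
  then have "int (n * t + 2 * n) - int k + 1 \<le> int (egz_mod (Zmod_square n) (n * t))"
    by linarith
  then show "(int t + 2) * int n - int k + 1 \<le> int (egz_mod (Zmod_square n) (n * t))"
    by (simp add: algebra_simps)
  \<comment> \<open>This is m(l - 1) + r for l = (t + 2)p - 2 and r = 4m - 3, as multiplicativity
    requires.\<close>
  let ?l = "(t + 2) * n + m - 3"
  have "?l + m = m * ((t + 2) * p - 2) + (4 * m - 3)"
  proof -
    obtain u v where "p = Suc u" "m = Suc v" using p2 m by (metis gr0_conv_Suc less_le_trans pos2)
    then show ?thesis unfolding assms(4) by (simp add: algebra_simps)
  qed
  then have "egz_index_bound (m * p) (m * (t * p)) ?l"
    by (rule egz_index_bound_mult[OF kemnitz_reiher[OF m] egz_index_bound_prime_multiple[OF assms(3,1)] m])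
  then have "egz_mod_bound (Zmod_square n) (n * t) ?l"
    using assms(2,4) m p2 by (intro egz_mod_bound_Zmod_square) (simp_all add: ac_simps)
  then have "egz_mod (Zmod_square n) (n * t) \<le> ?l"
    unfolding egz_mod_def by (rule Least_le)
  moreover have "3 \<le> (t + 2) * n + m" using nt assms(2) by (simp add: algebra_simps)
  ultimately have "int (egz_mod (Zmod_square n) (n * t)) \<le> int ((t + 2) * n + m) - 3"
    by linarith
  then show "int (egz_mod (Zmod_square n) (n * t)) \<le> (int t + 2) * int n + int m - 3"
    by (simp add: algebra_simps)
qed

end
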